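(* Let $X$ be a Banach space with the Radon-Nikodym property and let $\phi$ be a minimalizable measure of noncompactness on $X$. Then the modulus $\Delta_{X,\phi}$ is a subhomogeneous function, i.e. for all $k\in[0,1]$ and all $\varepsilon\in[0,\phi(\overline{B}_X)]$ $$\Delta_{X,\phi}(k\varepsilon)\leq k\,\Delta_{X,\phi}(\varepsilon).$$
   Context: $X$ is a Banach space, $B_X$ its open unit ball, $\overline{B}_X$ the closed unit ball, $\overline{B}(x,r)$ the closed ball of center $x$ and radius $r$; $\overline{A}$ is the closure of $A$, $\mathrm{co}A$ its convex hull, $\overline{\mathrm{co}}A$ its closed convex hull, and $d(0,A)=\inf_{a\in A}\|a\|$. Measure of noncompactness: let $\mathcal{B}$ be the family of bounded subsets of $X$. A map $\phi:\mathcal{B}\to[0,+\infty)$ is a measure of noncompactness if (1) $\phi(B)=0$ if and only if $B$ is relatively compact; (2) $\phi(B)=\phi(\overline{B})$ for all $B\in\mathcal{B}$; (3) $\phi(B_1\cup B_2)=\max\{\phi(B_1),\phi(B_2)\}$ for all $B_1,B_2\in\mathcal{B}$. An infinite bounded set $B$ is $\phi$-minimal if $\phi(D)=\phi(B)$ for every infinite subset $D\subset B$. The measure $\phi$ is minimalizable if for every infinite bounded set $A$ and every $\varepsilon>0$ there is a $\phi$-minimal subset $B\subset A$ with $\phi(B)\geq\phi(A)-\varepsilon$. Modulus of noncompact convexity associated with $\phi$: the function $\Delta_{X,\phi}:[0,\phi(\overline{B}_X)]\to[0,1]$, $$\Delta_{X,\phi}(\varepsilon)=\inf\{1-d(0,A):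 A\subseteq\overline{B}_X,\ A=\mathrm{co}A=\overline{A},\ \phi(A)>\varepsilon\},$$ where the infimum is taken in $[0,1]$, so that the infimum of the empty set (as at $\varepsilon=\phi(\overline{B}_X)$) is $1$. $X$ has the Radon-Nikodym property if every nonempty bounded subset $A\subset X$ is dentable, i.e. for every $\varepsilon>0$ there is $x\in A$ with $x\notin\overline{\mathrm{co}}(A\setminus\overline{B}(x,\varepsilon))$.
   Formalization: Proved with three added hypotheses, since the claim is false as stated: X is infinite-dimensional, φ is homogeneous (φ(cB)=|c|φ(B)) and φ is translation invariant. E.g. it fails for the fourth power of the Hausdorff measure on ℓ². *)

theory Defs
  imports "HOL-Analysis.Analysis"
begin

text \<open>
  The family of bounded subsets is encoded by a guard: a set function is total on
  \<^typ>\<open>'a set\<close>, but only its values on bounded sets are ever constrained or used.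
\<close>

definition measure_of_noncompactness :: "('a::banach set \<Rightarrow> real) \<Rightarrow> bool" where
  "measure_of_noncompactness \<phi> \<longleftrightarrow>
     (\<forall>B. bounded B \<longrightarrow> 0 \<le> \<phi> B) \<and>
     (\<forall>B. bounded B \<longrightarrow> (\<phi> B = 0 \<longleftrightarrow> compact (closure B))) \<and>
     (\<forall>B. bounded B \<longrightarrow> \<phi> B = \<phi> (closure B)) \<and>
     (\<forall>B1 B2. bounded B1 \<longrightarrow> bounded B2 \<longrightarrow> \<phi> (B1 \<union> B2) = max (\<phi> B1) (\<phi> B2))"

definition mnc_minimal :: "('a::banach set \<Rightarrow> real) \<Rightarrow> 'a set \<Rightarrow> bool" where
  "mnc_minimal \<phi> B \<longleftrightarrow>
     infinite B \<and> bounded B \<and> (\<forall>D. D \<subseteq> B \<longrightarrow> infinite D \<longrightarrow> \<phi> D = \<phi> B)"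

definition minimalizable :: "('a::banach set \<Rightarrow> real) \<Rightarrow> bool" where
  "minimalizable \<phi> \<longleftrightarrow>
     (\<forall>A. infinite A \<longrightarrow> bounded A \<longrightarrow>
        (\<forall>\<epsilon>>0. \<exists>B\<subseteq>A. mnc_minimal \<phi> B \<and> \<phi> B \<ge> \<phi> A - \<epsilon>))"

text \<open>
  The infimum is taken in the complete lattice \<open>[0,1]\<close>, where the empty set has infimum \<open>1\<close>;
  this is the real infimum after adjoining \<open>1\<close>.  For \<open>\<epsilon> \<ge> 0\<close> and a measure of
  noncompactness \<open>\<phi>\<close> the sets \<open>A\<close> below are nonempty, so the library convention
  \<^prop>\<open>infdist x {} = 0\<close> plays no role.
\<close>

definition noncompact_convexity_modulus :: "('a::banach set \<Rightarrow> real) \<Rightarrow> real \<Rightarrow> real" where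
  "noncompact_convexity_modulus \<phi> \<epsilon> =
     Inf (insert 1 {1 - infdist 0 A | A.
       A \<subseteq> cball 0 1 \<and> A = convex hull A \<and> A = closure A \<and> \<phi> A > \<epsilon>})"

definition dentable :: "'a::banach set \<Rightarrow> bool" where
  "dentable A \<longleftrightarrow> (\<forall>\<epsilon>>0. \<exists>x\<in>A. x \<notin> closure (convex hull (A - cball x \<epsilon>)))"

text \<open>The property belongs to a Banach space, hence to a type; it takes the type as argument.\<close>

definition radon_nikodym_property :: "'a::banach itself \<Rightarrow> bool" where
  "radon_nikodym_property _ \<longleftrightarrow> (\<forall>A::'a set. A \<noteq> {} \<longrightarrow> bounded A \<longrightarrow> dentable A)"

text \<open>
  The next three notions are not part of the definition of a measure of noncompactness.
  Subhomogeneity of the modulus is false without them: in a finite-dimensional space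
  \<open>\<phi> = 0\<close> and the modulus at \<open>0\<close> equals \<open>1\<close>; and on \<open>\<ell>\<^sup>2\<close>, with \<open>\<chi>\<close> the Hausdorff measure,
  \<open>\<chi>\<^sup>4\<close> is a minimalizable measure of noncompactness whose modulus is \<open>1\<close> at \<open>1\<close> but at
  least \<open>1 - 1/\<surd>2 > 1/4\<close> at \<open>1/4\<close>.
\<close>

definition infinite_dimensional :: "'a::banach itself \<Rightarrow> bool" where
  "infinite_dimensional _ \<longleftrightarrow> \<not> (\<exists>S::'a set. finite S \<and> span S = UNIV)"

definition mnc_homogeneous :: "('a::banach set \<Rightarrow> real) \<Rightarrow> bool" where
  "mnc_homogeneous \<phi> \<longleftrightarrow>
     (\<forall>B c. bounded B \<longrightarrow> \<phi> ((\<lambda>x. c *\<^sub>R x) ` B) = \<bar>c\<bar> * \<phi> B)"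

definition mnc_translation_invariant :: "('a::banach set \<Rightarrow> real) \<Rightarrow> bool" where
  "mnc_translation_invariant \<phi> \<longleftrightarrow>
     (\<forall>B a. bounded B \<longrightarrow> \<phi> ((\<lambda>x. a + x) ` B) = \<phi> B)"

end

theory Submission
  imports Defs
begin

text \<open>
  Write \<open>B\<close> for the closed unit ball and \<open>\<Delta>\<close> for the modulus, and let \<open>0 < k < 1\<close>.
  Let \<open>A\<close> be a competitor for \<open>\<Delta> \<epsilon>\<close>, that is, a closed convex subset of \<open>B\<close> with \<open>\<phi> A > \<epsilon>\<close>, and let \<open>d = d(0,A)\<close>.  For a
  unit vector \<open>x\<close> the set \<open>A' = (1 - k) x + k A\<close> is again a closed convex subset of \<open>B\<close>, and
  \<open>\<phi> A' = k \<phi> A > k \<epsilon>\<close> by homogeneity and translation invariance.  It remains to choose \<open>x\<close>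
  such that \<open>A'\<close> stays away from \<open>0\<close> by almost \<open>(1 - k) + k d\<close>, for then
  \<open>\<Delta> (k \<epsilon>) \<le> 1 - d(0,A') \<le> k (1 - d)\<close> up to an arbitrarily small error.

  If \<open>d > 0\<close>, take \<open>x\<close> in the direction of a point of \<open>A\<close> that almost realises the distance
  to \<open>0\<close>.  All points of \<open>A'\<close> are then multiples of points of \<open>A\<close>, by a factor that is
  known, and this bounds their norms from below
  (\<open>modulus_le_of_positive_distance\<close>).

  If \<open>d = 0\<close>, such a direction need not exist, and \<open>A\<close> is replaced by one half \<open>C\<close> of the unit
  ball.  For a fixed unit vector \<open>x\<close> there is a convex cone \<open>P\<close> that misses the open ball of radius
  \<open>1\<close> about \<open>-x\<close> and satisfies \<open>P \<union> - P = UNIV\<close>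
  (\<open>half_space_avoiding_convex\<close>); \<open>C\<close> is the intersection of \<open>B\<close> with the closure of \<open>P\<close>.
  Since \<open>B = C \<union> - C\<close>, the maximum property and homogeneity give \<open>\<phi> C = \<phi> B\<close>, so nothing of the
  measure is lost, while \<open>(1 - s) x + s C\<close> has distance at least \<open>1 - s\<close> from \<open>0\<close>.
  Letting \<open>s\<close> decrease to \<open>k\<close> gives \<open>\<Delta> e \<le> k\<close> for every \<open>e \<le> k \<phi> B\<close>
  (\<open>modulus_le_of_le_ball\<close>).  The same bound settles \<open>k = 0\<close>, where contraction by
  \<open>k\<close> would lose all of the measure, and the value \<open>1\<close> that the infimum takes when there are no
  competitors.  Here \<open>\<phi> B > 0\<close> is needed, which is Riesz's theorem: the unit ball of an
  infinite-dimensional space is not compact.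
\<close>

section \<open>Noncompactness of the unit ball\<close>

lemma infdist_less_witness:
  assumes "A \<noteq> {}" "infdist x A < e"
  obtains a where "a \<in> A" "dist x a < e"
proof -
  have "\<exists>a\<in>A. dist x a < e"
  proof (rule ccontr)
    assume "\<not> ?thesis"
    then have "e \<le> infdist x A"
      using assms(1) by (auto simp: infdist_notempty not_less intro!: cINF_greatest)
    with assms(2) show False by simp
  qed
  with that show ?thesis by blast
qed

text \<open>
  Adding one vector \<open>a\<close> to a closed subspace keeps it closed, because the coefficient of \<open>a\<close>
  is a Lipschitz function on the sum, with constant the inverse of the distance from \<open>a\<close> to the
  subspace; hence the coefficients of a convergent sequence converge.
\<close>

lemma closed_span_finite:
  fixes F :: "'a::real_normed_vector set"
  assumes "finite F"
  shows "closed (span F)"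
  using assms
proof (induction F)
  case empty
  then show ?case by simp
next
  case (insert a F)
  show ?case
  proof (cases "a \<in> span F")
    case True
    then show ?thesis using insert.IH by (simp add: span_redundant)
  next
    case False
    define d where "d = infdist a (span F)"
    have d: "d > 0"
      unfolding d_def
      by (rule infdist_pos_not_in_closed) (use insert.IH False span_zero in auto)
    have lip: "\<bar>r - s\<bar> * d \<le> dist x y"
      if "x - r *\<^sub>R a \<in> span F" "y - s *\<^sub>R a \<in> span F" for x y r s
    proof (cases "r = s")
      case False
      have "(x - r *\<^sub>R a) - (y - s *\<^sub>R a) \<in> span F"
        using that by (rule span_diff)
      then have "(- 1 / (r - s)) *\<^sub>R ((x - r *\<^sub>R a) - (y - s *\<^sub>R a)) \<in> span F"
        by (rule span_scale)
      moreover have "(- 1 / (r - s)) *\<^sub>R ((x - r *\<^sub>R a) - (y - s *\<^sub>R a))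
                       = a - (1 / (r - s)) *\<^sub>R (x - y)"
      proof -
        have "(x - r *\<^sub>R a) - (y - s *\<^sub>R a) = (x - y) - (r - s) *\<^sub>R a"
          by (simp add: algebra_simps)
        then have "(- 1 / (r - s)) *\<^sub>R ((x - r *\<^sub>R a) - (y - s *\<^sub>R a))
                     = ((r - s) / (r - s)) *\<^sub>R a - (1 / (r - s)) *\<^sub>R (x - y)"
          by (simp only: scaleR_diff_right scaleR_scaleR) simp
        then show ?thesis
          using False by simp
      qed
      ultimately have "d \<le> dist a (a - (1 / (r - s)) *\<^sub>R (x - y))"
        unfolding d_def by (metis infdist_le)
      also have "\<dots> = norm (x - y) / \<bar>r - s\<bar>"
        by (simp add: dist_norm)
      finally show ?thesis
        using False by (simp add: field_simps dist_norm)
    qed simp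
    show ?thesis
      unfolding closed_sequential_limits
    proof (intro allI impI, elim conjE)
      fix x l
      assume x: "\<forall>n. x n \<in> span (insert a F)" and l: "x \<longlonglongrightarrow> l"
      from x obtain k where k: "\<And>n. x n - k n *\<^sub>R a \<in> span F"
        unfolding span_breakdown_eq by metis
      have "Cauchy k"
      proof (rule metric_CauchyI)
        fix e :: real
        assume "e > 0"
        then obtain N where N: "\<And>m n. m \<ge> N \<Longrightarrow> n \<ge> N \<Longrightarrow> dist (x m) (x n) < e * d"
          using metric_CauchyD[OF LIMSEQ_imp_Cauchy[OF l], of "e * d"] d by auto
        show "\<exists>M. \<forall>m\<ge>M. \<forall>n\<ge>M. dist (k m) (k n) < e"
        proof (intro exI[of _ N] allI impI)
          fix m n assume "m \<ge> N" "n \<ge> N"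
          with N lip[OF k k, of m n] have "\<bar>k m - k n\<bar> * d < e * d"
            by (meson le_less_trans)
          then show "dist (k m) (k n) < e" using d by (simp add: dist_real_def)
        qed
      qed
      then obtain c where "k \<longlonglongrightarrow> c"
        using real_Cauchy_convergent convergent_def by blast
      then have "(\<lambda>n. x n - k n *\<^sub>R a) \<longlonglongrightarrow> l - c *\<^sub>R a"
        by (intro tendsto_intros l)
      then have "l - c *\<^sub>R a \<in> span F"
        using closed_sequentially[OF insert.IH, of "\<lambda>n. x n - k n *\<^sub>R a"] k by simp
      then show "l \<in> span (insert a F)"
        unfolding span_breakdown_eq by blast
    qed
  qed
qed

text \<open>
  Riesz's argument: the span \<open>S\<close> of a finite \<open>1/2\<close>-net of the ball is closed, and if it were proper,
  normalising a vector \<open>v - s\<close> whose length is less than twice the distance from \<open>v\<close> to \<open>S\<close> would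
  give a unit vector at distance more than \<open>1/2\<close> from \<open>S\<close>.
\<close>

lemma finite_span_of_compact_cball:
  assumes "compact (cball (0::'a::real_normed_vector) 1)"
  shows "\<exists>F::'a set. finite F \<and> span F = UNIV"
proof -
  obtain F :: "'a set" where F: "finite F" "cball 0 1 \<subseteq> (\<Union>x\<in>F. ball x (1/2))"
    using assms unfolding compact_eq_totally_bounded by (meson half_gt_zero zero_less_one)
  have "v \<in> span F" for v
  proof (rule ccontr)
    assume v: "v \<notin> span F"
    define d where "d = infdist v (span F)"
    have d: "d > 0"
      unfolding d_def
      by (rule infdist_pos_not_in_closed) (use closed_span_finite F v span_zero in auto)
    have "span F \<noteq> {}" "infdist v (span F) < 2 * d"
      using d span_zero unfolding d_def by auto
    then obtain s where s: "s \<in> span F" "dist v s < 2 * d"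
      by (rule infdist_less_witness)
    define t where "t = norm (v - s)"
    have t: "t > 0" using v s by (auto simp: t_def)
    then have "(1 / t) *\<^sub>R (v - s) \<in> cball 0 1" by (simp add: t_def)
    then obtain x where x: "x \<in> F" "dist x ((1 / t) *\<^sub>R (v - s)) < 1/2"
      using F by (meson UN_E mem_ball subsetD)
    have "s + t *\<^sub>R x \<in> span F"
      using s(1) span_scale[OF span_base[OF x(1)]] by (rule span_add)
    then have "d \<le> dist v (s + t *\<^sub>R x)"
      unfolding d_def by (rule infdist_le)
    also have "\<dots> = norm (t *\<^sub>R ((1 / t) *\<^sub>R (v - s) - x))"
      using t by (simp add: dist_norm algebra_simps)
    also have "\<dots> = t * dist x ((1 / t) *\<^sub>R (v - s))"
      using t by (simp add: dist_norm norm_minus_commute)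
    also have "\<dots> < t * (1/2)"
      using t x by (intro mult_strict_left_mono) auto
    also have "\<dots> < d"
      using s by (simp add: t_def dist_norm)
    finally show False .
  qed
  with F show ?thesis by blast
qed

section \<open>Half-spaces\<close>

text \<open>
  A geometric form of the Hahn-Banach theorem.  Take a maximal convex cone \<open>M\<close> that misses \<open>U\<close>.  If
  it contained neither \<open>y\<close> nor \<open>- y\<close>, then adding either ray to \<open>M\<close> would produce a point of \<open>U\<close>,
  say \<open>p + s y\<close> and \<open>q - r y\<close>; the convex combination of these points in which \<open>y\<close> cancels lies in
  both \<open>U\<close> and \<open>M\<close>.
\<close>

lemma half_space_avoiding_convex:
  fixes U :: "'a::real_vector set"
  assumes "convex U" "0 \<notin> U"
  obtains P where "convex_cone P" "P \<inter> U = {}" "\<And>x. x \<in> P \<or> - x \<in> P"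
proof -
  define \<A> where "\<A> = {P. convex_cone P \<and> P \<inter> U = {}}"
  have "{0} \<in> \<A>"
    using assms by (auto simp: \<A>_def convex_cone_iff)
  have "\<exists>M\<in>\<A>. \<forall>X\<in>\<A>. M \<subseteq> X \<longrightarrow> X = M"
  proof (rule subset_Zorn_nonempty)
    show "\<A> \<noteq> {}" using \<open>{0} \<in> \<A>\<close> by auto
    fix \<C> assume ne: "\<C> \<noteq> {}" and ch: "subset.chain \<A> \<C>"
    from ch have sub: "\<And>P. P \<in> \<C> \<Longrightarrow> convex_cone P \<and> P \<inter> U = {}"
      and lin: "\<And>P Q. P \<in> \<C> \<Longrightarrow> Q \<in> \<C> \<Longrightarrow> P \<subseteq> Q \<or> Q \<subseteq> P"
      unfolding subset_chain_def \<A>_def by auto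
    have "convex_cone (\<Union>\<C>)"
      unfolding convex_cone_iff
    proof (intro conjI ballI allI impI)
      show "0 \<in> \<Union>\<C>" using ne sub by (auto dest: convex_cone_contains_0)
      fix x assume x: "x \<in> \<Union>\<C>"
      show "x + y \<in> \<Union>\<C>" if y: "y \<in> \<Union>\<C>" for y
      proof -
        from x y obtain P Q where "P \<in> \<C>" "x \<in> P" "Q \<in> \<C>" "y \<in> Q" by blast
        with lin[of P Q] obtain P where "P \<in> \<C>" "x \<in> P" "y \<in> P" by blast
        then show ?thesis using sub[of P] convex_cone_add[of P x y] by blast
      qed
      show "c *\<^sub>R x \<in> \<Union>\<C>" if "c \<ge> 0" for c
      proof -
        from x obtain P where "P \<in> \<C>" "x \<in> P" by blast
        then show ?thesis using sub[of P] convex_cone_scaleR[of P c x] that by blast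
      qed
    qed
    then show "\<Union>\<C> \<in> \<A>" unfolding \<A>_def using sub by auto
  qed
  then obtain M where "M \<in> \<A>" and max': "\<forall>X\<in>\<A>. M \<subseteq> X \<longrightarrow> X = M"
    by (rule bexE)
  then have M: "convex_cone M" "M \<inter> U = {}"
    unfolding \<A>_def by auto
  have max: "X = M" if "convex_cone X" "X \<inter> U = {}" "M \<subseteq> X" for X
    using max' that unfolding \<A>_def by simp
  have extend: "\<exists>p s. p \<in> M \<and> s > 0 \<and> p + s *\<^sub>R y \<in> U" if y: "y \<notin> M" for y
  proof -
    define X where "X = {p + s *\<^sub>R y | p s. p \<in> M \<and> s \<ge> 0}"
    have "convex_cone X"
      unfolding convex_cone_iff
    proof (intro conjI ballI allI impI)
      have "0 = (0::'a) + 0 *\<^sub>R y" by simp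
      then show "0 \<in> X" unfolding X_def using convex_cone_contains_0[OF M(1)] by blast
      fix x assume "x \<in> X"
      then obtain p s where x: "x = p + s *\<^sub>R y" "p \<in> M" "s \<ge> 0" unfolding X_def by blast
      show "x + z \<in> X" if "z \<in> X" for z
      proof -
        from that obtain q r where z: "z = q + r *\<^sub>R y" "q \<in> M" "r \<ge> 0"
          unfolding X_def by blast
        have "x + z = (p + q) + (s + r) *\<^sub>R y" using x z by (simp add: algebra_simps)
        moreover have "p + q \<in> M" "s + r \<ge> 0" using x z convex_cone_add M by auto
        ultimately show ?thesis unfolding X_def by blast
      qed
      show "c *\<^sub>R x \<in> X" if "c \<ge> 0" for c
      proof -
        have "c *\<^sub>R x = c *\<^sub>R p + (c * s) *\<^sub>R y" using x by (simp add: algebra_simps)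
        moreover have "c *\<^sub>R p \<in> M" "c * s \<ge> 0" using x that convex_cone_scaleR M by auto
        ultimately show ?thesis unfolding X_def by blast
      qed
    qed
    moreover have "M \<subseteq> X"
    proof
      fix p assume "p \<in> M"
      moreover have "p = p + 0 *\<^sub>R y" by simp
      ultimately show "p \<in> X" unfolding X_def by blast
    qed
    moreover have "y \<in> X"
    proof -
      have "y = 0 + 1 *\<^sub>R y" by simp
      then show ?thesis
        unfolding X_def using convex_cone_contains_0[OF M(1)] zero_le_one by blast
    qed
    ultimately have "X \<inter> U \<noteq> {}" using max y by blast
    then obtain p s where ps: "p \<in> M" "s \<ge> 0" "p + s *\<^sub>R y \<in> U" unfolding X_def by blast
    moreover have "s \<noteq> 0" using ps M by auto
    ultimately show ?thesis by (metis less_eq_real_def)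
  qed
  have "y \<in> M \<or> - y \<in> M" for y
  proof (rule ccontr)
    assume "\<not> (y \<in> M \<or> - y \<in> M)"
    then obtain p s q r where p: "p \<in> M" "s > 0" "p + s *\<^sub>R y \<in> U"
      and q: "q \<in> M" "r > 0" "q + r *\<^sub>R (- y) \<in> U"
      using extend by metis
    define u where "u = r / (s + r)"
    define w where "w = s / (s + r)"
    have uw: "u \<ge> 0" "w \<ge> 0" "u + w = 1" "u * s = w * r"
      using p q by (auto simp: u_def w_def field_simps add_divide_distrib[symmetric])
    have "u *\<^sub>R (p + s *\<^sub>R y) + w *\<^sub>R (q + r *\<^sub>R (- y)) \<in> U"
      using assms(1) p q uw by (intro convexD)
    also have "u *\<^sub>R (p + s *\<^sub>R y) + w *\<^sub>R (q + r *\<^sub>R (- y)) = u *\<^sub>R p + w *\<^sub>R q"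
      using uw by (simp add: algebra_simps)
    finally have "u *\<^sub>R p + w *\<^sub>R q \<in> U" .
    moreover have "u *\<^sub>R p + w *\<^sub>R q \<in> M"
      using p q uw M by (intro convex_cone_add convex_cone_scaleR)
    ultimately show False using M by blast
  qed
  with M that show ?thesis by blast
qed

section \<open>Measures of noncompactness and the modulus\<close>

lemma mnc_Un:
  assumes "measure_of_noncompactness \<phi>" "bounded A" "bounded B"
  shows "\<phi> (A \<union> B) = max (\<phi> A) (\<phi> B)"
proof -
  have "\<forall>B1 B2. bounded B1 \<longrightarrow> bounded B2 \<longrightarrow> \<phi> (B1 \<union> B2) = max (\<phi> B1) (\<phi> B2)"
    using assms(1) unfolding measure_of_noncompactness_def by (elim conjE)
  with assms(2,3) show ?thesis by simp
qed

lemma mnc_zero_iff: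
  assumes "measure_of_noncompactness \<phi>" "bounded B"
  shows "\<phi> B = 0 \<longleftrightarrow> compact (closure B)"
proof -
  have "\<forall>B. bounded B \<longrightarrow> (\<phi> B = 0 \<longleftrightarrow> compact (closure B))"
    using assms(1) unfolding measure_of_noncompactness_def by (elim conjE)
  with assms(2) show ?thesis by simp
qed

lemma mnc_empty:
  assumes "measure_of_noncompactness \<phi>"
  shows "\<phi> {} = 0"
  using mnc_zero_iff[OF assms, of "{}"] by simp

lemma mnc_affine_image:
  assumes "mnc_homogeneous \<phi>" "mnc_translation_invariant \<phi>" "bounded B"
  shows "\<phi> ((\<lambda>x. a + c *\<^sub>R x) ` B) = \<bar>c\<bar> * \<phi> B"
proof -
  have "\<phi> ((\<lambda>x. a + x) ` (\<lambda>x. c *\<^sub>R x) ` B) = \<phi> ((\<lambda>x. c *\<^sub>R x) ` B)"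
    using assms(2) bounded_scaling[OF assms(3), of c] unfolding mnc_translation_invariant_def
    by blast
  with assms show ?thesis by (simp add: image_image mnc_homogeneous_def)
qed

lemma mnc_cball_pos:
  fixes \<phi> :: "'a::banach set \<Rightarrow> real"
  assumes "measure_of_noncompactness \<phi>" "infinite_dimensional TYPE('a)"
  shows "\<phi> (cball 0 1) > 0"
proof -
  have "\<not> compact (closure (cball (0::'a) 1))"
    using finite_span_of_compact_cball assms(2) unfolding infinite_dimensional_def by auto
  then show ?thesis
    using assms(1) mnc_zero_iff[OF assms(1), of "cball 0 1"]
    unfolding measure_of_noncompactness_def by (metis bounded_cball less_eq_real_def)
qed

lemma modulus_set_bdd_below:
  fixes \<phi> :: "'a::banach set \<Rightarrow> real"
  shows "bdd_below (insert 1 {1 - infdist 0 A | A.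
           A \<subseteq> cball 0 1 \<and> A = convex hull A \<and> A = closure A \<and> \<phi> A > \<epsilon>})"
proof -
  have "infdist 0 A \<le> 1" if "A \<subseteq> cball 0 1" for A :: "'a set"
  proof (cases "A = {}")
    case False
    then obtain a where "a \<in> A" by blast
    with that show ?thesis by (intro infdist_le2) auto
  qed (simp add: infdist_def)
  then show ?thesis by (intro bdd_belowI[of _ 0]) auto
qed

lemma modulus_le_one: "noncompact_convexity_modulus \<phi> \<epsilon> \<le> 1"
  unfolding noncompact_convexity_modulus_def
  by (rule cInf_lower[OF _ modulus_set_bdd_below]) simp

lemma modulus_le:
  assumes "A \<subseteq> cball 0 1" "convex A" "closed A" "\<phi> A > \<epsilon>"
    and "A \<noteq> {}" "\<And>a. a \<in> A \<Longrightarrow> norm a \<ge> m"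
  shows "noncompact_convexity_modulus \<phi> \<epsilon> \<le> 1 - m"
proof -
  have "A = convex hull A" "A = closure A"
    using assms by (simp_all add: hull_same closure_closed)
  then have "noncompact_convexity_modulus \<phi> \<epsilon> \<le> 1 - infdist 0 A"
    unfolding noncompact_convexity_modulus_def
    using assms(1,4)
    by (intro cInf_lower[OF _ modulus_set_bdd_below] insertI2 CollectI exI[of _ A] conjI refl)
  moreover have "m \<le> infdist 0 A"
    using assms by (auto simp: infdist_notempty intro!: cINF_greatest)
  ultimately show ?thesis by simp
qed

text \<open>
  Both constructions of competitors contract a set towards a unit vector; only the lower
  bound for the norms is specific to the set.
\<close>

lemma modulus_le_of_contraction:
  fixes \<phi> :: "'a::banach set \<Rightarrow> real"
  assumes "mnc_homogeneous \<phi>" "mnc_translation_invariant \<phi>"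
    and "A \<subseteq> cball 0 1" "convex A" "closed A" "A \<noteq> {}"
    and "norm x = 1" "0 < k" "k \<le> 1" "k * \<phi> A > e"
    and "\<And>a. a \<in> A \<Longrightarrow> norm ((1 - k) *\<^sub>R x + k *\<^sub>R a) \<ge> m"
  shows "noncompact_convexity_modulus \<phi> e \<le> 1 - m"
proof (rule modulus_le)
  let ?A = "(\<lambda>a. (1 - k) *\<^sub>R x + k *\<^sub>R a) ` A"
  show "?A \<subseteq> cball 0 1"
  proof (rule image_subsetI)
    fix a assume "a \<in> A"
    then have "norm a \<le> 1" using assms by auto
    have "norm ((1 - k) *\<^sub>R x + k *\<^sub>R a) \<le> norm ((1 - k) *\<^sub>R x) + norm (k *\<^sub>R a)"
      by (rule norm_triangle_ineq)
    also have "\<dots> \<le> (1 - k) + k * 1"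
      using assms \<open>norm a \<le> 1\<close> by (simp add: mult_left_le)
    finally show "(1 - k) *\<^sub>R x + k *\<^sub>R a \<in> cball 0 1" by simp
  qed
  show "convex ?A" using assms by (intro convex_affinity)
  have "closed ((\<lambda>a. (1 - k) *\<^sub>R x + a) ` (\<lambda>a. k *\<^sub>R a) ` A)"
    using assms by (intro closed_translation closed_scaling)
  then show "closed ?A" by (simp add: image_image)
  have "bounded A" using assms bounded_cball bounded_subset by blast
  then show "e < \<phi> ?A" using assms by (simp add: mnc_affine_image)
qed (use assms in auto)

section \<open>Competitors obtained by contraction\<close>

text \<open>
  The competitor is \<open>(1 - s) x + s C\<close>, where \<open>C\<close> is half of the unit ball \<open>B\<close>.  After division
  by \<open>1 - s\<close> its points have the form \<open>x + p\<close> with \<open>p\<close> in a cone that has distance at least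
  \<open>1\<close> from \<open>- x\<close>, so their norms are at least \<open>1 - s\<close>.
  The factor \<open>s > k\<close> makes the strict inequality \<open>s \<phi> C > k \<phi> B\<close> available even when \<open>e\<close> equals
  \<open>k \<phi> B\<close>; this is where \<open>\<phi> B > 0\<close> enters.
\<close>

lemma modulus_le_of_le_ball:
  fixes \<phi> :: "'a::banach set \<Rightarrow> real"
  assumes "measure_of_noncompactness \<phi>" "infinite_dimensional TYPE('a)"
    and "mnc_homogeneous \<phi>" "mnc_translation_invariant \<phi>"
    and "0 \<le> k" "k < 1" "e \<le> k * \<phi> (cball 0 1)"
  shows "noncompact_convexity_modulus \<phi> e \<le> k"
proof -
  have "UNIV \<noteq> {0::'a}"
    using assms(2) unfolding infinite_dimensional_def by (metis finite.emptyI span_empty)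
  then obtain y :: 'a where "y \<noteq> 0" by blast
  define x where "x = (1 / norm y) *\<^sub>R y"
  have x: "norm x = 1" using \<open>y \<noteq> 0\<close> by (simp add: x_def)
  obtain P where P: "convex_cone P" "P \<inter> ball (- x) 1 = {}" "\<And>z. z \<in> P \<or> - z \<in> P"
    by (rule half_space_avoiding_convex[of "ball (- x) 1"]) (use x in auto)
  define C where "C = closure P \<inter> cball 0 1"
  have "bounded C" unfolding C_def by (simp add: bounded_Int)
  then have "\<phi> (C \<union> uminus ` C) = max (\<phi> C) (\<phi> (uminus ` C))"
    by (intro mnc_Un[OF assms(1)]) (simp_all add: bounded_uminus)
  moreover have "\<phi> (uminus ` C) = \<phi> C"
    using mnc_affine_image[OF assms(3,4) \<open>bounded C\<close>, of 0 "- 1"] by simp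
  moreover have "cball 0 1 = C \<union> uminus ` C"
  proof
    show "cball 0 1 \<subseteq> C \<union> uminus ` C"
    proof
      fix z :: 'a assume z: "z \<in> cball 0 1"
      show "z \<in> C \<union> uminus ` C"
      proof (cases "z \<in> P")
        case True
        then show ?thesis using z closure_subset unfolding C_def by blast
      next
        case False
        then have "- z \<in> closure P" using P(3) closure_subset by blast
        then have "- z \<in> C" using z unfolding C_def by simp
        then show ?thesis by (metis UnI2 image_eqI minus_minus)
      qed
    qed
  qed (auto simp: C_def)
  ultimately have \<phi>C: "\<phi> C = \<phi> (cball 0 1)"
    by simp
  have ne: "C \<noteq> {}"
  proof -
    have "0 \<in> C"
      unfolding C_def using convex_cone_contains_0[OF P(1)] closure_subset by fastforce
    then show ?thesis by blast
  qed
  \<comment> \<open>\<open>closure P\<close> is again a cone, and it misses the ball about \<open>- x\<close> because that ball is open.\<close>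
  have bound: "1 \<le> norm (x + r *\<^sub>R c)" if "c \<in> closure P" "r \<ge> 0" for c r
  proof -
    have "(\<lambda>c. r *\<^sub>R c) ` closure P \<subseteq> closure P"
    proof -
      have "(\<lambda>c. r *\<^sub>R c) ` P \<subseteq> P" using P(1) \<open>r \<ge> 0\<close> convex_cone_scaleR by blast
      then show ?thesis by (metis closure_mono closure_scaleR)
    qed
    moreover have "closure P \<inter> ball (- x) 1 = {}"
      using P(2) open_Int_closure_eq_empty[of "ball (- x) 1" P] by (auto simp: Int_commute)
    ultimately have "r *\<^sub>R c \<notin> ball (- x) 1" using that by blast
    moreover have "dist (- x) (r *\<^sub>R c) = norm (x + r *\<^sub>R c)"
    proof -
      have "- x - r *\<^sub>R c = - (x + r *\<^sub>R c)" by simp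
      then show ?thesis by (simp only: dist_norm norm_minus_cancel)
    qed
    ultimately show ?thesis by simp
  qed
  have "noncompact_convexity_modulus \<phi> e \<le> s" if s: "k < s" "s < 1" for s
  proof -
    have "noncompact_convexity_modulus \<phi> e \<le> 1 - (1 - s)"
    proof (rule modulus_le_of_contraction[OF assms(3,4), of C x s])
      show "convex C"
        unfolding C_def using P(1) by (simp add: convex_Int convex_closure convex_cone_def)
      have "k * \<phi> (cball 0 1) < s * \<phi> (cball 0 1)"
        using s mnc_cball_pos[OF assms(1,2)] by simp
      then show "s * \<phi> C > e" using \<phi>C assms by simp
      fix c assume "c \<in> C"
      then have "1 \<le> norm (x + (s / (1 - s)) *\<^sub>R c)"
        using s assms by (intro bound) (auto simp: C_def)
      then have "(1 - s) * 1 \<le> (1 - s) * norm (x + (s / (1 - s)) *\<^sub>R c)"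
        using s by (intro mult_left_mono) auto
      also have "\<dots> = norm ((1 - s) *\<^sub>R (x + (s / (1 - s)) *\<^sub>R c))"
        using s by simp
      also have "(1 - s) *\<^sub>R (x + (s / (1 - s)) *\<^sub>R c) = (1 - s) *\<^sub>R x + s *\<^sub>R c"
        using s by (simp add: scaleR_add_right)
      finally show "1 - s \<le> norm ((1 - s) *\<^sub>R x + s *\<^sub>R c)" by simp
    qed (use x s assms ne in \<open>auto simp: C_def\<close>)
    then show ?thesis by simp
  qed
  then show ?thesis using dense_ge_bounded[OF \<open>k < 1\<close>] by blast
qed

text \<open>
  Choose \<open>a\<^sub>0\<close> in \<open>A\<close> of norm \<open>r\<close> close to the distance \<open>d\<close> and contract towards \<open>a\<^sub>0 / r\<close>.
  With \<open>\<lambda> = (1 - k) / r + k\<close> each point \<open>(1 - k) a\<^sub>0 / r + k a\<close> is \<open>\<lambda>\<close> times a convex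
  combination of \<open>a\<^sub>0\<close> and \<open>a\<close>, hence has norm at least \<open>\<lambda> d\<close>, which tends to \<open>(1 - k) + k d\<close>
  as \<open>r\<close> tends to \<open>d\<close>.
\<close>

lemma modulus_le_of_positive_distance:
  fixes \<phi> :: "'a::banach set \<Rightarrow> real"
  assumes "mnc_homogeneous \<phi>" "mnc_translation_invariant \<phi>"
    and "A \<subseteq> cball 0 1" "convex A" "closed A" "A \<noteq> {}" "\<phi> A > \<epsilon>"
    and "0 < k" "k \<le> 1" "infdist 0 A > 0"
  shows "noncompact_convexity_modulus \<phi> (k * \<epsilon>) \<le> k * (1 - infdist 0 A)"
proof -
  define d where "d = infdist 0 A"
  have d: "d > 0" using assms by (simp add: d_def)
  have norm_ge: "d \<le> norm a" if "a \<in> A" for a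
    using infdist_le[OF that, of 0] by (simp add: d_def)
  have approx: "noncompact_convexity_modulus \<phi> (k * \<epsilon>) \<le> 1 - ((1 - k) * (d / r) + k * d)"
    if a0: "a0 \<in> A" "r = norm a0" for a0 r
  proof (rule modulus_le_of_contraction[OF assms(1,2,3,4,5,6)])
    have r: "r > 0" using norm_ge[of a0] a0 d by auto
    show "norm ((1 / r) *\<^sub>R a0) = 1" using a0 r by simp
    show "k * \<epsilon> < k * \<phi> A" using assms by simp
    fix a assume a: "a \<in> A"
    define l where "l = (1 - k) / r + k"
    have l: "l > 0" using r assms by (simp add: l_def add_nonneg_pos)
    define u where "u = (1 - k) / r / l"
    define v where "v = k / l"
    have "u + v = l / l"
      by (simp only: u_def v_def add_divide_distrib[symmetric] l_def[symmetric])
    then have uv: "u \<ge> 0" "v \<ge> 0" "u + v = 1" "l * u = (1 - k) / r" "l * v = k"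
      using r l assms(8,9) by (simp_all add: u_def v_def)
    have "u *\<^sub>R a0 + v *\<^sub>R a \<in> A"
      using assms(4) a0 a uv by (intro convexD)
    then have "l * d \<le> l * norm (u *\<^sub>R a0 + v *\<^sub>R a)"
      using norm_ge l by simp
    also have "\<dots> = norm (l *\<^sub>R (u *\<^sub>R a0 + v *\<^sub>R a))"
      using l by simp
    also have "l *\<^sub>R (u *\<^sub>R a0 + v *\<^sub>R a) = (1 - k) *\<^sub>R ((1 / r) *\<^sub>R a0) + k *\<^sub>R a"
      using uv by (simp add: scaleR_add_right)
    finally show "(1 - k) * (d / r) + k * d
                    \<le> norm ((1 - k) *\<^sub>R ((1 / r) *\<^sub>R a0) + k *\<^sub>R a)"
      by (simp add: l_def algebra_simps)
  qed (use assms in auto)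
  have lt: "noncompact_convexity_modulus \<phi> (k * \<epsilon>) \<le> 1 - ((1 - k) * t + k * d)"
    if t: "0 < t" "t < 1" for t
  proof -
    \<comment> \<open>A point of norm below \<open>d / t\<close> makes the ratio \<open>d / r\<close> exceed \<open>t\<close>.\<close>
    have "infdist 0 A < d / t"
      using d t by (simp add: d_def field_simps)
    with assms(6) obtain a0 where a0: "a0 \<in> A" "dist 0 a0 < d / t"
      by (rule infdist_less_witness)
    have "norm a0 > 0" using norm_ge[OF a0(1)] d by linarith
    then have "t \<le> d / norm a0" using a0 t by (simp add: field_simps)
    then have "(1 - k) * t \<le> (1 - k) * (d / norm a0)"
      using assms by (intro mult_left_mono) auto
    with approx[OF a0(1) refl] show ?thesis by simp
  qed
  have "(1 - k) * t \<le> 1 - k * d - noncompact_convexity_modulus \<phi> (k * \<epsilon>)"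
    if "0 < t" "t < 1" for t
    using lt[OF that] by simp
  moreover have "((\<lambda>t. (1 - k) * t) \<longlongrightarrow> (1 - k) * 1) (at_left 1)"
    by (intro tendsto_intros)
  moreover have "eventually (\<lambda>t. t \<in> {0<..<1::real}) (at_left 1)"
    by (rule eventually_at_leftI[of 0]) auto
  ultimately have "(1 - k) * 1 \<le> 1 - k * d - noncompact_convexity_modulus \<phi> (k * \<epsilon>)"
    by (intro tendsto_upperbound[of "\<lambda>t. (1 - k) * t" _ "at_left 1"])
       (auto elim!: eventually_mono)
  then show ?thesis by (simp add: d_def algebra_simps)
qed

section \<open>Subhomogeneity\<close>

theorem theorem2p1:
  fixes \<phi> :: "'a::banach set \<Rightarrow> real"
  assumes "radon_nikodym_property TYPE('a)"
    and "measure_of_noncompactness \<phi>"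
    and "minimalizable \<phi>"
    and "infinite_dimensional TYPE('a)"
    and "mnc_homogeneous \<phi>"
    and "mnc_translation_invariant \<phi>"
  shows "\<forall>k\<in>{0..1}. \<forall>\<epsilon>\<in>{0..\<phi> (cball 0 1)}.
           noncompact_convexity_modulus \<phi> (k * \<epsilon>) \<le> k * noncompact_convexity_modulus \<phi> \<epsilon>"
proof (intro ballI)
  fix k \<epsilon> :: real
  assume k: "k \<in> {0..1}" and \<epsilon>: "\<epsilon> \<in> {0..\<phi> (cball 0 1)}"
  let ?\<Delta> = "noncompact_convexity_modulus \<phi>"
  let ?S = "insert 1 {1 - infdist 0 A | A.
       A \<subseteq> cball 0 1 \<and> A = convex hull A \<and> A = closure A \<and> \<phi> A > \<epsilon>}"
  have le_k: "?\<Delta> (k * \<epsilon>) \<le> k"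
  proof (cases "k = 1")
    case True
    then show ?thesis by (simp add: modulus_le_one)
  next
    case False
    with k \<epsilon> show ?thesis
      by (intro modulus_le_of_le_ball[OF assms(2,4,5,6)]) (auto intro: mult_left_mono)
  qed
  show "?\<Delta> (k * \<epsilon>) \<le> k * ?\<Delta> \<epsilon>"
  proof (cases "k = 0")
    case True
    then show ?thesis using le_k by simp
  next
    case False
    with k have k0: "0 < k" "k \<le> 1" by auto
    \<comment> \<open>Competitors at distance \<open>0\<close> contribute \<open>z = 1\<close>, just as the adjoined \<open>1\<close> does.\<close>
    have "?\<Delta> (k * \<epsilon>) / k \<le> z" if "z \<in> ?S" for z
    proof -
      from that consider "z = 1"
        | A where "z = 1 - infdist 0 A" "A \<subseteq> cball 0 1" "A = convex hull A" "A = closure A"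
            "\<phi> A > \<epsilon>"
        by blast
      then have "?\<Delta> (k * \<epsilon>) \<le> k * z"
      proof cases
        case 1
        then show ?thesis using le_k by simp
      next
        case 2
        have A: "convex A" "closed A"
          by (subst 2(3), rule convex_convex_hull) (subst 2(4), rule closed_closure)
        have "\<phi> {} = 0"
          using assms(2) by (rule mnc_empty)
        then have "A \<noteq> {}" using 2(5) \<epsilon> by auto
        show ?thesis
        proof (cases "infdist 0 A > 0")
          case True
          then show ?thesis
            using modulus_le_of_positive_distance[OF assms(5,6) 2(2) A \<open>A \<noteq> {}\<close> 2(5) k0] 2(1)
            by simp
        next
          case False
          then have "infdist 0 A = 0" using infdist_nonneg[of 0 A] by simp
          then show ?thesis using le_k 2(1) by simp
        qed
      qed
      then show ?thesis using k0 by (simp add: field_simps)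
    qed
    then have "?\<Delta> (k * \<epsilon>) / k \<le> ?\<Delta> \<epsilon>"
      unfolding noncompact_convexity_modulus_def[of \<phi> \<epsilon>] by (intro cInf_greatest) auto
    then show ?thesis using k0 by (simp add: field_simps)
  qed
qed

end
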